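(* Let $X$ be a non-empty open set in a real Banach space, let $Y$ be a real Banach space, let $C\subseteq Y$ be a closed set such that $Y\setminus C$ is convex, let $I\subseteq\mathbb{R}$ be an interval containing $0$, and let $f,g:X\to Y$ be continuously Fréchet differentiable. Assume that: $(a_1)$ the set $f^{-1}(C)$ is non-empty and the set $\{(f(x),g(x)) : x\in f^{-1}(C)\}$ is compact in $Y\times Y$; $(a_2)$ for each $x\in X$, there exists $\lambda\in I$ such that $f(x)+\lambda g(x)\in Y\setminus C$. Then there exist $x^*\in X$ and $\lambda^*\in I$ such that $$f(x^* )+\lambda^*g(x^* )\in\partial C$$ and the continuous linear operator $f'(x^* )+\lambda^*g'(x^* )$ is not invertible.
   Context: "Interval" means a non-empty connected subset of $\mathbb{R}$ with more than one point. $\partial$ denotes the topological boundary in $Y$. $f'(x)$, $g'(x)$ denote the Fréchet derivatives at $x$, which are continuous linear operators from the Banach space containing $X$ into $Y$. *)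

theory Defs
  imports "HOL-Analysis.Analysis"
begin

definition blinfun_invertible ::
    "('a::real_normed_vector \<Rightarrow>\<^sub>L 'b::real_normed_vector) \<Rightarrow> bool" where
  "blinfun_invertible A \<longleftrightarrow>
     (\<exists>B :: 'b \<Rightarrow>\<^sub>L 'a. B o\<^sub>L A = id_blinfun \<and> A o\<^sub>L B = id_blinfun)"

(* Meant for open S. The derivative F' is a map into the space of bounded linear
   operators, and its continuity refers to the operator norm. *)
definition has_continuous_frechet_derivative_on ::
    "('a::real_normed_vector \<Rightarrow> 'b::real_normed_vector) \<Rightarrow> ('a \<Rightarrow> 'a \<Rightarrow>\<^sub>L 'b) \<Rightarrow> 'a set \<Rightarrow> bool" where
  "has_continuous_frechet_derivative_on F F' S \<longleftrightarrow>
     (\<forall>x\<in>S. (F has_derivative blinfun_apply (F' x)) (at x)) \<and> continuous_on S F'"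

definition nondegenerate_interval :: "real set \<Rightarrow> bool" where
  "nondegenerate_interval J \<longleftrightarrow> connected J \<and> (\<exists>a\<in>J. \<exists>b\<in>J. a \<noteq> b)"

end

theory Submission
  imports Defs
begin

text \<open>Let A be the open convex complement of C. If f x is in C, the parameters l in I with
  f x + l g x in A form an interval that misses 0, so they all have the same sign; say it is
  positive for some x, and let t be their infimum. The points (f x, g x) of positive sign form a
  compact set, on which t is upper semicontinuous, so t attains a maximum there, at some x, and
  p = f x + t g x lies on the boundary of C. Were f' x + t g' x invertible, f + t g would map a
  neighbourhood of x onto a neighbourhood of p, so some y near x would be sent to a point q of the
  interior of C, opposite to A. Since f y + l g y is still in A for a fixed l > t, convexity forces
  f y in C, and the first hitting parameter of y is larger than t, a contradiction.\<close>

section \<open>Differentiable maps and local surjectivity\<close>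

lemma has_continuous_frechet_derivative_on_imp_continuous_on:
  assumes "has_continuous_frechet_derivative_on F F' S"
  shows "continuous_on S F"
  using assms unfolding has_continuous_frechet_derivative_on_def
  by (meson continuous_at_imp_continuous_on has_derivative_continuous)

lemma has_continuous_frechet_derivative_on_add_scaleR:
  assumes "has_continuous_frechet_derivative_on f f' S"
    and "has_continuous_frechet_derivative_on g g' S"
  shows "has_continuous_frechet_derivative_on (\<lambda>x. f x + c *\<^sub>R g x) (\<lambda>x. f' x + c *\<^sub>R g' x) S"
  using assms unfolding has_continuous_frechet_derivative_on_def
  by (auto intro!: derivative_eq_intros continuous_intros simp: blinfun.bilinear_simps)

text \<open>The preimages of a point y near F x are the fixed points of z - B (F z - y), where B
  inverts the derivative at x; on a small ball around x this map is a contraction.\<close>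

lemma image_in_interior_of_invertible_derivative:
  fixes F :: "'a::banach \<Rightarrow> 'b::banach"
  assumes "open N" "x \<in> N"
    and F: "has_continuous_frechet_derivative_on F F' N"
    and inv: "blinfun_invertible (F' x)"
  shows "F x \<in> interior (F ` N)"
proof -
  obtain B :: "'b \<Rightarrow>\<^sub>L 'a" where BA: "B o\<^sub>L F' x = id_blinfun" and AB: "F' x o\<^sub>L B = id_blinfun"
    using inv unfolding blinfun_invertible_def by blast
  \<comment> \<open>Adding 1 keeps the bound positive even when \<open>B\<close> is zero, so it can
    be divided by.\<close>
  define b where "b = norm B + 1"
  have b: "b > 0" "norm B \<le> b" by (auto simp: b_def add_nonneg_pos)
  have contF: "continuous_on N F'"
    and derF: "\<And>z. z \<in> N \<Longrightarrow> (F has_derivative blinfun_apply (F' z)) (at z)"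
    using F unfolding has_continuous_frechet_derivative_on_def by auto
  have "isCont F' x"
    using contF \<open>open N\<close> \<open>x \<in> N\<close> continuous_on_eq_continuous_at by blast
  then obtain d where d: "d > 0" "\<And>z. dist z x < d \<Longrightarrow> dist (F' z) (F' x) < 1 / (2 * b)"
    using b unfolding continuous_at_eps_delta by (metis half_gt_zero_iff zero_less_divide_1_iff zero_less_mult_iff zero_less_numeral)
  obtain e where e: "e > 0" "cball x e \<subseteq> N"
    using \<open>open N\<close> \<open>x \<in> N\<close> open_contains_cball by blast
  define r where "r = min e (d / 2)"
  have r: "r > 0" "cball x r \<subseteq> N" and rd: "\<And>z. z \<in> cball x r \<Longrightarrow> dist z x < d"
    using e d(1) by (auto simp: r_def dist_commute)
  define h where "h z = z - B (F z)" for z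
  have lip: "norm (h z - h w) \<le> 1/2 * norm (z - w)" if "z \<in> cball x r" "w \<in> cball x r" for z w
  proof (rule differentiable_bound[OF convex_cball _ _ that])
    fix y assume y: "y \<in> cball x r"
    \<comment> \<open>Because \<open>B\<close> inverts \<open>F' x\<close>, the derivative
      \<open>v - B (F' y v)\<close> of \<open>h\<close> factors through \<open>F' x - F' y\<close>,
      whose norm is below \<open>1 / (2 * b)\<close> on the ball; hence the contraction constant
      1/2.\<close>
    let ?D = "B o\<^sub>L (F' x - F' y)"
    have D: "blinfun_apply ?D = (\<lambda>v. v - B (F' y v))"
    proof
      fix v
      have "B (F' x v) = v"
        using arg_cong[OF BA, of "\<lambda>T. blinfun_apply T v"] by simp
      then show "?D v = v - B (F' y v)" by (simp add: blinfun.bilinear_simps)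
    qed
    have "(F has_derivative blinfun_apply (F' y)) (at y within cball x r)"
      using derF r y by (meson has_derivative_at_withinI subsetD)
    then show "(h has_derivative blinfun_apply ?D) (at y within cball x r)"
      unfolding D h_def by (auto intro!: derivative_eq_intros)
    have "norm ?D \<le> norm B * norm (F' x - F' y)" by (rule norm_blinfun_compose)
    also have "\<dots> \<le> b * (1 / (2 * b))"
      using d(2)[OF rd[OF y]] b by (intro mult_mono) (auto simp: dist_norm norm_minus_commute)
    also have "\<dots> = 1/2" using b by simp
    finally show "onorm (blinfun_apply ?D) \<le> 1/2" by (simp add: norm_blinfun.rep_eq)
  qed
  \<comment> \<open>With this radius \<open>B (y - F x)\<close> has norm at most
    \<open>r / 2\<close>; the contraction contributes at most another \<open>r / 2\<close>, so the
    ball around \<open>x\<close> is mapped into itself.\<close>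
  have "ball (F x) (r / (2 * b)) \<subseteq> F ` N"
  proof
    fix y assume y: "y \<in> ball (F x) (r / (2 * b))"
    define \<Phi> where "\<Phi> z = h z + B y" for z
    have "\<Phi> ` cball x r \<subseteq> cball x r"
    proof safe
      fix z assume z: "z \<in> cball x r"
      have "norm (B (y - F x)) \<le> b * (r / (2 * b))"
        using norm_blinfun[of B "y - F x"] mult_mono[of "norm B" b "norm (y - F x)" "r / (2 * b)"] y b
        by (auto simp: dist_norm norm_minus_commute)
      then have 1: "norm (B (y - F x)) \<le> r / 2" using b by simp
      have "\<Phi> z - x = (h z - h x) + B (y - F x)"
        by (simp add: \<Phi>_def h_def blinfun.bilinear_simps)
      then have "norm (\<Phi> z - x) \<le> norm (h z - h x) + norm (B (y - F x))"
        by (metis norm_triangle_ineq)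
      moreover have "norm (h z - h x) \<le> 1/2 * norm (z - x)"
        using lip[OF z] r by simp
      moreover have "norm (z - x) \<le> r" using z by (simp add: dist_norm norm_minus_commute)
      ultimately have "norm (\<Phi> z - x) \<le> r" using 1 by linarith
      then show "\<Phi> z \<in> cball x r" by (simp add: dist_norm norm_minus_commute)
    qed
    moreover have "dist (\<Phi> z) (\<Phi> w) \<le> 1/2 * dist z w" if "z \<in> cball x r" "w \<in> cball x r" for z w
      using lip[OF that] by (simp add: dist_norm \<Phi>_def)
    ultimately have "\<exists>!z\<in>cball x r. \<Phi> z = z"
      using r by (intro Banach_fix[where c="1/2"]) (auto simp: complete_eq_closed)
    then obtain z where z: "z \<in> cball x r" "\<Phi> z = z" by blast
    \<comment> \<open>The fixed point only gives a zero of \<open>B\<close>; the other inverse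
      identity makes \<open>B\<close> injective.\<close>
    then have "B (y - F z) = 0" by (simp add: \<Phi>_def h_def blinfun.bilinear_simps)
    moreover have "F' x (B (y - F z)) = y - F z"
      using arg_cong[OF AB, of "\<lambda>T. blinfun_apply T (y - F z)"] by simp
    ultimately have "y = F z" by (simp add: blinfun.bilinear_simps)
    then show "y \<in> F ` N" using z r by blast
  qed
  then show ?thesis
    using r b by (intro interiorI[of "ball (F x) (r / (2 * b))"]) auto
qed

section \<open>Convex sets and semicontinuity\<close>

text \<open>If the point opposite to \<open>a\<close> were a limit of \<open>A\<close>, some
  \<open>z\<close> in \<open>A\<close> close to it would have its own opposite point close to
  \<open>a\<close>, hence in \<open>A\<close>, and \<open>p\<close> would lie on the segment between
  the two.\<close>

lemma open_convex_reflection_notin_closure: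
  fixes A :: "'b::real_normed_vector set"
  assumes "open A" "convex A" "a \<in> A" "p \<notin> A" "s > 0"
  shows "p + s *\<^sub>R (p - a) \<notin> closure A"
proof
  let ?q = "p + s *\<^sub>R (p - a)"
  assume q: "?q \<in> closure A"
  \<comment> \<open>Chosen so that \<open>p\<close> is the convex combination of
    \<open>\<phi> z\<close> and \<open>z\<close> with weights \<open>s / (1 + s)\<close> and
    \<open>1 / (1 + s)\<close>.\<close>
  define \<phi> where "\<phi> z = ((1 + s) / s) *\<^sub>R p - (1 / s) *\<^sub>R z" for z
  have "\<phi> ?q = a"
    using \<open>s > 0\<close> by (simp add: \<phi>_def algebra_simps add_divide_distrib)
  moreover have "open (\<phi> -` A)"
    unfolding \<phi>_def by (intro open_vimage \<open>open A\<close> continuous_intros)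
  ultimately obtain z where z: "z \<in> A" "\<phi> z \<in> A"
    using q \<open>a \<in> A\<close> by (metis (no_types, lifting) disjoint_iff open_Int_closure_eq_empty vimageE vimageI)
  have "(s / (1 + s)) *\<^sub>R \<phi> z + (1 / (1 + s)) *\<^sub>R z \<in> A"
    using \<open>s > 0\<close> by (intro convexD[OF \<open>convex A\<close>] z) (auto simp: divide_simps)
  moreover have "(s / (1 + s)) *\<^sub>R \<phi> z + (1 / (1 + s)) *\<^sub>R z = p"
    using \<open>s > 0\<close> by (simp add: \<phi>_def scaleR_diff_right)
  ultimately show False using \<open>p \<notin> A\<close> by simp
qed

text \<open>Without a maximum the sets where \<open>h\<close> is below \<open>h y\<close>, for
  \<open>y\<close> in \<open>K\<close>, cover \<open>K\<close>. In a finite subcover, the index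
  point with the largest value of \<open>h\<close> is left uncovered.\<close>

lemma upper_semicontinuous_attains_sup:
  fixes h :: "'a::topological_space \<Rightarrow> 'b::linorder"
  assumes "compact K" "K \<noteq> {}"
    and usc: "\<And>r. openin (top_of_set K) {z \<in> K. h z < r}"
  shows "\<exists>z\<in>K. \<forall>y\<in>K. h y \<le> h z"
proof (rule ccontr)
  assume "\<not> ?thesis"
  then have ex: "\<And>z. z \<in> K \<Longrightarrow> \<exists>y\<in>K. h z < h y" by (meson not_le)
  obtain U where U: "\<And>r. open (U r)" "\<And>r. {z \<in> K. h z < r} = K \<inter> U r"
    using usc unfolding openin_open by metis
  have "K \<subseteq> (\<Union>y\<in>K. U (h y))" using ex U(2) by fastforce
  with \<open>compact K\<close> U(1) obtain D where D: "D \<subseteq> K" "finite D" "K \<subseteq> (\<Union>y\<in>D. U (h y))"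
    by (metis compactE_image)
  then have "D \<noteq> {}" using \<open>K \<noteq> {}\<close> by auto
  with D(2) have "Max (h ` D) \<in> h ` D" by (intro Max_in) auto
  then obtain m where m: "m \<in> D" "h m = Max (h ` D)" by auto
  then have m_ge: "h y \<le> h m" if "y \<in> D" for y using D(2) that by simp
  from m(1) D obtain y where "y \<in> D" "m \<in> U (h y)" by blast
  then have "h m < h y" using U(2)[of "h y"] m(1) D(1) by blast
  with m_ge[OF \<open>y \<in> D\<close>] show False by simp
qed

text \<open>The infimum is below \<open>r\<close> exactly when some parameter \<open>l < r\<close>
  hits \<open>A\<close>, and for fixed \<open>l\<close> hitting is an open condition on
  \<open>z\<close>. This is the upper semicontinuity of the first hitting parameter.\<close>

lemma openin_hitting_time_less:
  fixes A :: "'b::real_normed_vector set" and J :: "real set"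
  assumes "open A" "bdd_below J"
    and hit: "\<And>z. z \<in> K \<Longrightarrow> \<exists>l\<in>J. fst z + l *\<^sub>R snd z \<in> A"
  shows "openin (top_of_set K) {z \<in> K. Inf {l \<in> J. fst z + l *\<^sub>R snd z \<in> A} < r}"
proof -
  have "{z \<in> K. Inf {l \<in> J. fst z + l *\<^sub>R snd z \<in> A} < r}
      = K \<inter> (\<Union>l \<in> {l \<in> J. l < r}. (\<lambda>z. fst z + l *\<^sub>R snd z) -` A)"
  proof -
    have "Inf {l \<in> J. fst z + l *\<^sub>R snd z \<in> A} < r \<longleftrightarrow> (\<exists>l\<in>J. l < r \<and> fst z + l *\<^sub>R snd z \<in> A)"
      if "z \<in> K" for z
    proof -
      have "bdd_below {l \<in> J. fst z + l *\<^sub>R snd z \<in> A}"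
        using \<open>bdd_below J\<close> by (rule bdd_below_mono) auto
      then show ?thesis using hit[OF that] by (subst cInf_less_iff) auto
    qed
    then show ?thesis by auto
  qed
  moreover have "open (\<Union>l \<in> {l \<in> J. l < r}. (\<lambda>z. fst z + l *\<^sub>R snd z) -` A)"
    by (intro open_UN ballI open_vimage \<open>open A\<close> continuous_intros)
  ultimately show ?thesis by (simp only: openin_open_Int)
qed

lemma convex_line_between:
  assumes "convex A" "u + l *\<^sub>R v \<in> A" "u + m *\<^sub>R v \<in> A" "l \<le> k" "k \<le> (m::real)"
  shows "u + k *\<^sub>R v \<in> A"
proof (cases "l = m")
  case False
  then have lm: "l < m" using assms by linarith
  define c where "c = (k - l) / (m - l)"
  have c: "0 \<le> c" "c \<le> 1" "k = l + c * (m - l)" using assms lm by (auto simp: c_def divide_simps)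
  have "(1 - c) *\<^sub>R (u + l *\<^sub>R v) + c *\<^sub>R (u + m *\<^sub>R v) \<in> A"
    using assms c by (intro convexD) auto
  also have "(1 - c) *\<^sub>R (u + l *\<^sub>R v) + c *\<^sub>R (u + m *\<^sub>R v) = u + k *\<^sub>R v"
    unfolding c(3) by (simp add: algebra_simps)
  finally show ?thesis .
qed (use assms in auto)

section \<open>Maximizing the first hitting parameter\<close>

text \<open>This is the case of a starting point of positive sign; the negative case follows from it
  by a change of sign.\<close>

lemma singular_point_of_positive_hit:
  fixes X :: "'a::banach set" and C :: "'b::banach set" and f g :: "'a \<Rightarrow> 'b"
  assumes "open X" and "closed C" and cvx: "convex (- C)"
    and "connected I" and "0 \<in> I"
    and df: "has_continuous_frechet_derivative_on f f' X"
    and dg: "has_continuous_frechet_derivative_on g g' X"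
    and cpt: "compact {(f x, g x) | x. x \<in> X \<and> f x \<in> C}"
    and a2: "\<And>x. x \<in> X \<Longrightarrow> \<exists>l\<in>I. f x + l *\<^sub>R g x \<in> - C"
    and start: "x0 \<in> X" "f x0 \<in> C" "l0 \<in> I" "0 < l0" "f x0 + l0 *\<^sub>R g x0 \<in> - C"
  shows "\<exists>x\<in>X. \<exists>l\<in>I. f x + l *\<^sub>R g x \<in> frontier C \<and> \<not> blinfun_invertible (f' x + l *\<^sub>R g' x)"
proof -
  have "open (- C)" using \<open>closed C\<close> by (simp add: open_Compl)
  note betw = convex_line_between[OF cvx]
  have contf: "continuous_on X f" and contg: "continuous_on X g"
    using df dg by (auto intro: has_continuous_frechet_derivative_on_imp_continuous_on)
  define J where "J = {l \<in> I. 0 < l}"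
  define S where "S z = {l \<in> J. fst z + l *\<^sub>R snd z \<in> - C}" for z :: "'b \<times> 'b"
  \<comment> \<open>The value is meaningful only where \<open>S z\<close> is non-empty, which
    \<open>K_hit\<close> provides on \<open>K\<close>.\<close>
  define \<tau> where "\<tau> z = Inf (S z)" for z
  have bdd: "bdd_below J" unfolding J_def by (rule bdd_belowI[of _ 0]) auto
  have bddS: "bdd_below (S z)" for z
    using bdd by (rule bdd_below_mono) (auto simp: S_def)
  \<comment> \<open>These are the pairs hit by a negative parameter. They form an open set, so
    removing them preserves compactness and leaves the pairs of positive sign.\<close>
  define N where "N = (\<Union>l \<in> {l \<in> I. l < 0}. (\<lambda>z. fst z + l *\<^sub>R snd z) -` (- C))"
  define K where "K = {(f x, g x) | x. x \<in> X \<and> f x \<in> C} - N"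
  have "open N"
    unfolding N_def by (intro open_UN ballI open_vimage \<open>open (- C)\<close> continuous_intros)
  then have "compact K" unfolding K_def using cpt by (rule compact_diff[rotated])
  \<comment> \<open>A negative hit together with the positive hit \<open>l\<close> would put
    \<open>f x\<close> itself, the point at parameter 0, outside \<open>C\<close>.\<close>
  have KI: "(f x, g x) \<in> K" if x: "x \<in> X" "f x \<in> C" and l: "l \<in> S (f x, g x)" for x l
  proof -
    have "f x + m *\<^sub>R g x \<notin> - C" if "m < 0" for m
      using betw[of "f x" m "g x" l 0] that l x by (auto simp: S_def J_def)
    then have "(f x, g x) \<notin> N" unfolding N_def by auto
    then show ?thesis using x unfolding K_def by blast
  qed
  have K_hit: "\<exists>l\<in>J. fst z + l *\<^sub>R snd z \<in> - C" if "z \<in> K" for z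
  proof -
    obtain x where x: "x \<in> X" "f x \<in> C" "z = (f x, g x)" "z \<notin> N"
      using \<open>z \<in> K\<close> unfolding K_def by auto
    obtain l where l: "l \<in> I" "f x + l *\<^sub>R g x \<in> - C" using a2[OF x(1)] by blast
    have "l \<noteq> 0" using l x by auto
    moreover have "\<not> l < 0" using l x unfolding N_def by auto
    ultimately show ?thesis using l x unfolding J_def by auto
  qed
  have "l0 \<in> S (f x0, g x0)" using start by (auto simp: S_def J_def)
  then have "K \<noteq> {}" using KI[OF start(1,2)] by blast
  moreover have "openin (top_of_set K) {z \<in> K. \<tau> z < r}" for r
    unfolding \<tau>_def S_def by (rule openin_hitting_time_less[OF \<open>open (- C)\<close> bdd K_hit])
  ultimately obtain z where z: "z \<in> K" "\<And>y. y \<in> K \<Longrightarrow> \<tau> y \<le> \<tau> z"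
    using upper_semicontinuous_attains_sup[OF \<open>compact K\<close>] by blast
  then obtain x where x: "x \<in> X" "f x \<in> C" "z = (f x, g x)" unfolding K_def by blast
  define t where "t = \<tau> z"
  define p where "p = f x + t *\<^sub>R g x"
  have Sne: "S z \<noteq> {}" using K_hit[OF z(1)] by (auto simp: S_def)
  then obtain l where l: "l \<in> S z" by blast
  then have lI: "l \<in> I" "0 < l" "f x + l *\<^sub>R g x \<in> - C" by (auto simp: S_def J_def x)
  have tle: "t \<le> k" if "k \<in> S z" for k
    unfolding t_def \<tau>_def using that bddS by (rule cInf_lower)
  have "0 \<le> t"
    unfolding t_def \<tau>_def using Sne by (intro cInf_greatest) (auto simp: S_def J_def)
  then have tI: "t \<in> I"
    using connected_contains_Icc[OF \<open>connected I\<close> \<open>0 \<in> I\<close> lI(1)] tle[OF l] by auto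
  \<comment> \<open>The complement of \<open>C\<close> is open, so if \<open>t\<close> were a hit,
    then \<open>t > 0\<close> and slightly smaller positive parameters would also hit, against the
    infimum.\<close>
  have "p \<in> C"
  proof (rule ccontr)
    assume "p \<notin> C"
    then have "t > 0" using \<open>0 \<le> t\<close> x by (cases "t = 0") (auto simp: p_def)
    have "open ((\<lambda>k. f x + k *\<^sub>R g x) -` (- C))"
      by (intro open_vimage \<open>open (- C)\<close> continuous_intros)
    moreover have "t \<in> (\<lambda>k. f x + k *\<^sub>R g x) -` (- C)" using \<open>p \<notin> C\<close> by (simp add: p_def)
    ultimately obtain e where e: "e > 0" "ball t e \<subseteq> (\<lambda>k. f x + k *\<^sub>R g x) -` (- C)"
      by (meson open_contains_ball)
    \<comment> \<open>The first term keeps \<open>k\<close> positive, the second keeps it within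
      \<open>e\<close> of \<open>t\<close>.\<close>
    define k where "k = max (t / 2) (t - e / 2)"
    have k: "0 < k" "k < t" "k \<in> ball t e" using e \<open>t > 0\<close> by (auto simp: k_def dist_real_def)
    have "k \<in> I"
      using connected_contains_Icc[OF \<open>connected I\<close> \<open>0 \<in> I\<close> tI] k by auto
    then have "k \<in> S z" using k e by (auto simp: S_def J_def x)
    with tle k show False by force
  qed
  have "p \<in> closure (- C)"
  proof -
    have "t \<in> closure (S z)"
      unfolding t_def \<tau>_def using Sne bddS by (rule closure_contains_Inf)
    then have "f x + t *\<^sub>R g x \<in> closure ((\<lambda>k. f x + k *\<^sub>R g x) ` S z)"
      using continuous_image_closure_subset[of UNIV "\<lambda>k. f x + k *\<^sub>R g x" "S z"]
      by (force intro: continuous_intros)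
    moreover have "(\<lambda>k. f x + k *\<^sub>R g x) ` S z \<subseteq> - C" by (auto simp: S_def x)
    ultimately show ?thesis unfolding p_def by (meson closure_mono subsetD)
  qed
  then have "p \<in> frontier C"
    using \<open>p \<in> C\<close> closure_subset[of C] by (auto simp: frontier_closures)
  moreover have "\<not> blinfun_invertible (f' x + t *\<^sub>R g' x)"
  proof
    assume inv: "blinfun_invertible (f' x + t *\<^sub>R g' x)"
    have "l \<noteq> t" using lI(3) \<open>p \<in> C\<close> by (auto simp: p_def)
    then have "t < l" using tle[OF l] by simp
    \<comment> \<open>On this open neighbourhood of \<open>x\<close> the fixed parameter
      \<open>l\<close> remains a hit.\<close>
    define M where "M = X \<inter> (\<lambda>y. f y + l *\<^sub>R g y) -` (- C)"
    define H where "H y = f y + t *\<^sub>R g y" for y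
    have "open M"
      unfolding M_def using \<open>open X\<close> \<open>closed C\<close>
      by (intro continuous_open_preimage continuous_intros contf contg)
    moreover have "x \<in> M" using x lI by (simp add: M_def)
    moreover have "has_continuous_frechet_derivative_on H (\<lambda>y. f' y + t *\<^sub>R g' y) M"
    proof -
      have "has_continuous_frechet_derivative_on H (\<lambda>y. f' y + t *\<^sub>R g' y) X"
        unfolding H_def by (rule has_continuous_frechet_derivative_on_add_scaleR[OF df dg])
      then show ?thesis
        unfolding has_continuous_frechet_derivative_on_def M_def
        by (auto intro: continuous_on_subset)
    qed
    ultimately have "H x \<in> interior (H ` M)"
      using inv image_in_interior_of_invertible_derivative by blast
    then have p: "p \<in> interior (H ` M)" by (simp add: H_def p_def)
    define a where "a = f x + l *\<^sub>R g x"
    \<comment> \<open>The points opposite to \<open>a\<close> tend to \<open>p\<close> as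
      \<open>s\<close> decreases to 0, so one of them is a value of \<open>H\<close> on
      \<open>M\<close>.\<close>
    have "((\<lambda>s. p + s *\<^sub>R (p - a)) \<longlongrightarrow> p + 0 *\<^sub>R (p - a)) (at_right 0)"
      by (intro tendsto_intros)
    then have "\<forall>\<^sub>F s in at_right 0. p + s *\<^sub>R (p - a) \<in> interior (H ` M)"
      using p by (intro topological_tendstoD) auto
    moreover have "\<forall>\<^sub>F s in at_right (0::real). s > 0"
      by (simp add: eventually_at_right_less)
    ultimately have "\<forall>\<^sub>F s in at_right (0::real). s > 0 \<and> p + s *\<^sub>R (p - a) \<in> interior (H ` M)"
      by eventually_elim simp
    then obtain s :: real where s: "s > 0" "p + s *\<^sub>R (p - a) \<in> interior (H ` M)"
      using eventually_happens'[OF trivial_limit_at_right_real] by blast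
    then obtain y where y: "y \<in> M" "p + s *\<^sub>R (p - a) = H y"
      using interior_subset by blast
    then have yM: "y \<in> X" "f y + l *\<^sub>R g y \<in> - C" by (auto simp: M_def)
    have "H y \<notin> closure (- C)"
      using open_convex_reflection_notin_closure[OF \<open>open (- C)\<close> cvx _ _ s(1), of a p] lI \<open>p \<in> C\<close> y
      by (simp add: a_def)
    then have Hy: "H y \<in> interior C" by (simp add: closure_complement)
    \<comment> \<open>Otherwise 0 and \<open>l\<close> would both be hits, and so would
      \<open>t\<close> between them, but \<open>H y\<close> is in \<open>C\<close>.\<close>
    have "f y \<in> C"
      using betw[of "f y" 0 "g y" l t] yM \<open>0 \<le> t\<close> \<open>t < l\<close> Hy interior_subset[of C]
      by (auto simp: H_def)
    moreover have ly: "l \<in> S (f y, g y)" using yM lI by (simp add: S_def J_def)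
    ultimately have "\<tau> (f y, g y) \<le> t" unfolding t_def using KI yM z(2) by blast
    have "open ((\<lambda>k. f y + k *\<^sub>R g y) -` interior C)"
      by (intro open_vimage continuous_intros) auto
    moreover have "t \<in> (\<lambda>k. f y + k *\<^sub>R g y) -` interior C" using Hy by (simp add: H_def)
    ultimately obtain e where e: "e > 0" "ball t e \<subseteq> (\<lambda>k. f y + k *\<^sub>R g y) -` interior C"
      by (meson open_contains_ball)
    \<comment> \<open>No hit lies within \<open>e\<close> of \<open>t\<close>, and one below
      \<open>t\<close> would, together with \<open>l\<close>, make \<open>t\<close> a hit. The
      uniform gap \<open>e\<close> keeps the inequality strict when passing to the infimum.\<close>
    have "t + e \<le> k" if k: "k \<in> S (f y, g y)" for k
    proof (rule ccontr)
      assume "\<not> t + e \<le> k"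
      have kC: "f y + k *\<^sub>R g y \<in> - C" using k by (simp add: S_def)
      then have "k \<notin> ball t e" using e interior_subset[of C] by auto
      then have "k \<le> t" using \<open>\<not> t + e \<le> k\<close> by (auto simp: dist_real_def)
      then have "H y \<in> - C"
        unfolding H_def using betw kC yM \<open>t < l\<close> by (meson less_imp_le)
      then show False using Hy interior_subset by blast
    qed
    then have "t + e \<le> \<tau> (f y, g y)"
      unfolding \<tau>_def using ly by (intro cInf_greatest) auto
    with \<open>\<tau> (f y, g y) \<le> t\<close> \<open>e > 0\<close> show False by simp
  qed
  ultimately show ?thesis using x tI unfolding p_def by blast
qed

section \<open>Reduction by the sign of the parameter\<close>

theorem theorem6:
  fixes X :: "'a::banach set"
    and C :: "'b::banach set"
    and I :: "real set"
    and f g :: "'a \<Rightarrow> 'b"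
    and f' g' :: "'a \<Rightarrow> 'a \<Rightarrow>\<^sub>L 'b"
  assumes "open X" and "X \<noteq> {}"
    and "closed C" and "convex (UNIV - C)"
    and "nondegenerate_interval I" and "0 \<in> I"
    and "has_continuous_frechet_derivative_on f f' X"
    and "has_continuous_frechet_derivative_on g g' X"
    and a1: "{x \<in> X. f x \<in> C} \<noteq> {}"
            "compact {(f x, g x) | x. x \<in> X \<and> f x \<in> C}"
    and a2: "\<forall>x\<in>X. \<exists>l\<in>I. f x + l *\<^sub>R g x \<in> UNIV - C"
  shows "\<exists>xs\<in>X. \<exists>ls\<in>I. f xs + ls *\<^sub>R g xs \<in> frontier C \<and>
           \<not> blinfun_invertible (f' xs + ls *\<^sub>R g' xs)"
proof -
  have cvx: "convex (- C)" using assms by (simp add: Compl_eq_Diff_UNIV)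
  have conn: "connected I" using assms by (simp add: nondegenerate_interval_def)
  have hit: "\<exists>l\<in>I. f x + l *\<^sub>R g x \<in> - C" if "x \<in> X" for x using a2 that by auto
  obtain x0 where x0: "x0 \<in> X" "f x0 \<in> C" using a1 by blast
  obtain l0 where l0: "l0 \<in> I" "f x0 + l0 *\<^sub>R g x0 \<in> - C" using hit x0 by blast
  then have "l0 \<noteq> 0" using x0 by auto
  then consider "l0 > 0" | "l0 < 0" by linarith
  then show ?thesis
  proof cases
    case 1
    show ?thesis
      by (rule singular_point_of_positive_hit[OF assms(1,3) cvx conn assms(6-8) a1(2) hit x0 l0(1) 1 l0(2)])
  next
    case 2
    \<comment> \<open>Replacing \<open>g\<close> by \<open>- g\<close> and \<open>I\<close> by its
      reflection leaves every \<open>f x + l *\<^sub>R g x\<close> unchanged when \<open>l\<close>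
      becomes \<open>- l\<close>, and turns \<open>l0\<close> into a positive parameter.\<close>
    have dg: "has_continuous_frechet_derivative_on (\<lambda>x. - g x) (\<lambda>x. - g' x) X"
      using assms(8) unfolding has_continuous_frechet_derivative_on_def
      by (auto intro!: derivative_eq_intros continuous_intros simp: blinfun.bilinear_simps)
    have "continuous_on UNIV (\<lambda>z::'b \<times> 'b. (fst z, - snd z))"
      by (intro continuous_intros)
    then have "compact ((\<lambda>z. (fst z, - snd z)) ` {(f x, g x) | x. x \<in> X \<and> f x \<in> C})"
      using a1(2) by (meson compact_continuous_image continuous_on_subset subset_UNIV)
    also have "(\<lambda>z. (fst z, - snd z)) ` {(f x, g x) | x. x \<in> X \<and> f x \<in> C}
        = {(f x, - g x) | x. x \<in> X \<and> f x \<in> C}"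
      by force
    finally have cpt: "compact {(f x, - g x) | x. x \<in> X \<and> f x \<in> C}" .
    have conn': "connected (uminus ` I)"
      using conn by (intro connected_continuous_image continuous_intros)
    have hit': "\<exists>l\<in>uminus ` I. f x + l *\<^sub>R (- g x) \<in> - C" if "x \<in> X" for x
      using hit[OF that] by auto
    have "\<exists>x\<in>X. \<exists>l\<in>uminus ` I. f x + l *\<^sub>R (- g x) \<in> frontier C \<and>
        \<not> blinfun_invertible (f' x + l *\<^sub>R (- g' x))"
      using 2 l0 \<open>0 \<in> I\<close>
      by (intro singular_point_of_positive_hit[OF assms(1,3) cvx conn' _ assms(7) dg cpt hit' x0, of "- l0"])
        (auto simp: image_iff)
    then show ?thesis by auto
  qed
qed

end
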